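(* Assume $\nu$ is a probability measure. If $h_m(X)$ is a positive $m$-eigenvalue of $\Delta_1^m$, then, for any $m$-eigenfunction $u$ associated to $h_m(X)$ with $\nu(E_0(u))>0$, $$\left(h_m(X),\frac1{\nu(E_0(u))}\chi_{E_0(u)}\right)\ \text{ is an } m\text{-eigenpair of } \Delta_1^m,$$ $\nu(E_0(u))\le\frac12$, and $$h_m(X)=\lambda^m_{E_0(u)}.$$ Moreover, both $E_0(u)$ and $X\setminus E_0(u)$ are $m$-calibrable.
   Context: Metric random walk space: $(X,d)$ is a Polish metric space with its Borel $\sigma$-algebra and $m=(m_x)_{x\in X}$ is a family of Borel probability measures on $X$ such that $x\mapsto m_x(A)$ is Borel for every Borel set $A$, and each $m_x$ has finite first moment ($\int_X d(z,y)\,dm_x(y)<\infty$ for some, hence every, $z\in X$). $\nu$ is a Radon probability measure on $X$ that is invariant, $\nu(A)=\int_X m_x(A)\,d\nu(x)$, and reversible for $m$: for every Borel $C\subset X\times X$, $\int_X\int_X\chi_C(x,y)\,dm_x(y)d\nu(x)=\int_X\int_X\chi_C(x,y)\,dm_y(x)d\nu(y)$. Put $L_m(A,B)=\int_A\int_B dm_x(y)d\nu(x)$; the space is assumed $m$-connected: $L_m(A,B)>0$ for any $\nu$-measurable sets $A,B$ of positive $\nu$-measure with $A\cup B=X$. $E_0(u)=\{x\in X: u(x)>0\}$. $P_m(E)=L_m(E,X\setminus E)$ and, for $\nu$-measurable $D$ with $0<\nu(D)<1$, $\lambda_D^m:=\frac{P_m(D)}{\nu(D)}$. Such a $D$ is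 $m$-calibrable if $\lambda_D^m=\inf\left\{\frac{P_m(E)}{\nu(E)}: E\subset D \ \nu\text{-measurable},\ \nu(E)>0\right\}$. The $m$-Cheeger constant of $X$ is $h_m(X)=\inf\left\{\frac{P_m(D)}{\nu(D)}: D\subset X \ \nu\text{-measurable},\ 0<\nu(D)\le\frac12\right\}$. For $\nu$-measurable $u$, $TV_m(u)=\frac12\int_X\int_X|u(y)-u(x)|\,dm_x(y)d\nu(x)$; $\mathcal F_m:L^2(X,\nu)\to[0,+\infty]$, $\mathcal F_m(u)=TV_m(u)$. $w\in\partial\mathcal F_m(u)$ iff $\mathcal F_m(u)<\infty$ and $\mathcal F_m(z)\ge\mathcal F_m(u)+\int_X w(z-u)\,d\nu$ for all $z\in L^2(X,\nu)$; $v\in\Delta_1^m u$ iff $-v\in\partial\mathcal F_m(u)$. Multivalued sign: $\mathrm{sign}(r)=1$ if $r>0$, $[-1,1]$ if $r=0$, $-1$ if $r<0$. A pair $(\lambda,u)\in\mathbb R\times L^2(X,\nu)$ is an $m$-eigenpair of $\Delta_1^m$ if $\|u\|_{L^1(X,\nu)}=1$ and there is a function $\xi$ with $\xi(x)\in\mathrm{sign}(u(x))$ such that $\lambda\xi\in\partial\mathcal F_m(u)=-\Delta_1^m u$; $u$ is then an $m$-eigenfunction (eigenvector) associated to the $m$-eigenvalue $\lambda$. *)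

theory Defs
  imports "HOL-Probability.Probability"
begin

text \<open>
  The space \<open>X\<close> is the whole type \<open>'a :: polish_space\<close> (complete separable metric space).
  The measures \<open>m x\<close> and \<open>\<nu>\<close> live on the Borel sets. ``\<open>\<nu>\<close>-measurable'' means measurable for
  \<open>completion \<nu>\<close>. If \<open>\<nu>\<close> is invariant, then a \<open>\<nu>\<close>-measurable set is \<open>m x\<close>-measurable, in the sense
  of \<open>completion (m x)\<close>, for \<open>\<nu>\<close>-almost every \<open>x\<close>; therefore the iterated integrals below use both
  completions, and the junk values at the remaining \<open>x\<close> do not contribute.
\<close>

definition radon_measure :: "'a::topological_space measure \<Rightarrow> bool" where
  "radon_measure \<nu> \<longleftrightarrow>
     sets \<nu> = sets borel \<and>
     (\<forall>x. \<exists>U. open U \<and> x \<in> U \<and> emeasure \<nu> U < \<infinity>) \<and>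
     (\<forall>A\<in>sets borel. emeasure \<nu> A = (SUP K\<in>{K. compact K \<and> K \<subseteq> A}. emeasure \<nu> K))"

locale metric_random_walk_space =
  fixes m :: "'a::polish_space \<Rightarrow> 'a measure"
  assumes prob_space_walk: "\<And>x. prob_space (m x)"
    and sets_walk: "\<And>x. sets (m x) = sets borel"
    and measurable_walk: "\<And>A. A \<in> sets borel \<Longrightarrow> (\<lambda>x. emeasure (m x) A) \<in> borel_measurable borel"
    and first_moment: "\<And>x. \<exists>z. (\<integral>\<^sup>+ y. ennreal (dist z y) \<partial>m x) < \<infinity>"

locale reversible_random_walk_space = metric_random_walk_space m
  for m :: "'a::polish_space \<Rightarrow> 'a measure" +
  fixes \<nu> :: "'a measure"
  assumes prob_space_nu: "prob_space \<nu>"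
    and radon_nu: "radon_measure \<nu>"
    and invariant: "\<And>A. A \<in> sets borel \<Longrightarrow> emeasure \<nu> A = (\<integral>\<^sup>+ x. emeasure (m x) A \<partial>\<nu>)"
    and reversible: "\<And>C :: ('a \<times> 'a) set. C \<in> sets borel \<Longrightarrow>
      (\<integral>\<^sup>+ x. (\<integral>\<^sup>+ y. indicator C (x, y) \<partial>m x) \<partial>\<nu>) = (\<integral>\<^sup>+ y. (\<integral>\<^sup>+ x. indicator C (x, y) \<partial>m y) \<partial>\<nu>)"

definition m_interaction ::
    "('a \<Rightarrow> 'a measure) \<Rightarrow> 'a measure \<Rightarrow> 'a set \<Rightarrow> 'a set \<Rightarrow> ennreal" where
  "m_interaction m \<nu> A B =
     (\<integral>\<^sup>+ x. indicator A x * emeasure (completion (m x)) B \<partial>completion \<nu>)"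

definition m_connected :: "('a \<Rightarrow> 'a measure) \<Rightarrow> 'a measure \<Rightarrow> bool" where
  "m_connected m \<nu> \<longleftrightarrow>
     (\<forall>A\<in>sets (completion \<nu>). \<forall>B\<in>sets (completion \<nu>).
        0 < emeasure (completion \<nu>) A \<longrightarrow> 0 < emeasure (completion \<nu>) B \<longrightarrow> A \<union> B = UNIV \<longrightarrow>
        0 < m_interaction m \<nu> A B)"

definition m_perimeter :: "('a \<Rightarrow> 'a measure) \<Rightarrow> 'a measure \<Rightarrow> 'a set \<Rightarrow> ennreal" where
  "m_perimeter m \<nu> E = m_interaction m \<nu> E (- E)"

definition m_ratio :: "('a \<Rightarrow> 'a measure) \<Rightarrow> 'a measure \<Rightarrow> 'a set \<Rightarrow> ennreal" where
  "m_ratio m \<nu> D = m_perimeter m \<nu> D / emeasure (completion \<nu>) D"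

definition m_calibrable :: "('a \<Rightarrow> 'a measure) \<Rightarrow> 'a measure \<Rightarrow> 'a set \<Rightarrow> bool" where
  "m_calibrable m \<nu> D \<longleftrightarrow>
     D \<in> sets (completion \<nu>) \<and>
     0 < emeasure (completion \<nu>) D \<and> emeasure (completion \<nu>) D < 1 \<and>
     m_ratio m \<nu> D =
       (INF E\<in>{E \<in> sets (completion \<nu>). E \<subseteq> D \<and> 0 < emeasure (completion \<nu>) E}. m_ratio m \<nu> E)"

text \<open>The infimum is taken in \<open>[0, \<infinity>]\<close>: it is \<open>\<infinity>\<close> if there is no admissible set.\<close>

definition m_cheeger_constant :: "('a \<Rightarrow> 'a measure) \<Rightarrow> 'a measure \<Rightarrow> ennreal" where
  "m_cheeger_constant m \<nu> =
     (INF D\<in>{D \<in> sets (completion \<nu>).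
              0 < measure (completion \<nu>) D \<and> measure (completion \<nu>) D \<le> 1/2}. m_ratio m \<nu> D)"

definition total_variation ::
    "('a \<Rightarrow> 'a measure) \<Rightarrow> 'a measure \<Rightarrow> ('a \<Rightarrow> real) \<Rightarrow> ennreal" where
  "total_variation m \<nu> u =
     (\<integral>\<^sup>+ x. (\<integral>\<^sup>+ y. ennreal \<bar>u y - u x\<bar> \<partial>completion (m x)) \<partial>completion \<nu>) / 2"

text \<open>Elements of \<open>L\<^sup>2(X, \<nu>)\<close> are represented by functions rather than by classes of functions.\<close>

definition L2 :: "'a measure \<Rightarrow> ('a \<Rightarrow> real) set" where
  "L2 \<nu> = {u \<in> borel_measurable (completion \<nu>). integrable (completion \<nu>) (\<lambda>x. (u x)\<^sup>2)}"

definition subdifferential_TV ::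
    "('a \<Rightarrow> 'a measure) \<Rightarrow> 'a measure \<Rightarrow> ('a \<Rightarrow> real) \<Rightarrow> ('a \<Rightarrow> real) set" where
  "subdifferential_TV m \<nu> u =
     {w \<in> L2 \<nu>. u \<in> L2 \<nu> \<and> total_variation m \<nu> u < \<infinity> \<and>
        (\<forall>z\<in>L2 \<nu>. enn2ereal (total_variation m \<nu> u)
            + ereal (\<integral>x. w x * (z x - u x) \<partial>completion \<nu>)
          \<le> enn2ereal (total_variation m \<nu> z))}"

definition one_laplacian ::
    "('a \<Rightarrow> 'a measure) \<Rightarrow> 'a measure \<Rightarrow> ('a \<Rightarrow> real) \<Rightarrow> ('a \<Rightarrow> real) set" where
  "one_laplacian m \<nu> u = {v. - v \<in> subdifferential_TV m \<nu> u}"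

definition multi_sign :: "real \<Rightarrow> real set" where
  "multi_sign r = (if r > 0 then {1} else if r = 0 then {-1..1} else {-1})"

text \<open>
  The membership \<open>\<lambda>\<xi> \<in> - \<Delta>\<^sub>1 u\<close> is written as \<open>- \<lambda>\<xi> \<in> \<Delta>\<^sub>1 u\<close>.
\<close>

definition m_eigenpair ::
    "('a \<Rightarrow> 'a measure) \<Rightarrow> 'a measure \<Rightarrow> real \<Rightarrow> ('a \<Rightarrow> real) \<Rightarrow> bool" where
  "m_eigenpair m \<nu> lam u \<longleftrightarrow>
     u \<in> L2 \<nu> \<and> (\<integral>x. \<bar>u x\<bar> \<partial>completion \<nu>) = 1 \<and>
     (\<exists>\<xi>. (\<forall>x. \<xi> x \<in> multi_sign (u x)) \<and> - (\<lambda>x. lam * \<xi> x) \<in> one_laplacian m \<nu> u)"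

definition m_eigenvalue :: "('a \<Rightarrow> 'a measure) \<Rightarrow> 'a measure \<Rightarrow> real \<Rightarrow> bool" where
  "m_eigenvalue m \<nu> lam \<longleftrightarrow> (\<exists>u. m_eigenpair m \<nu> lam u)"

lemma m_eigenpair_iff_subdifferential:
  "m_eigenpair m \<nu> lam u \<longleftrightarrow>
     u \<in> L2 \<nu> \<and> (\<integral>x. \<bar>u x\<bar> \<partial>completion \<nu>) = 1 \<and>
     (\<exists>\<xi>. (\<forall>x. \<xi> x \<in> multi_sign (u x)) \<and> (\<lambda>x. lam * \<xi> x) \<in> subdifferential_TV m \<nu> u)"
  by (simp add: m_eigenpair_def one_laplacian_def fun_Compl_def)

definition positivity_set :: "('a \<Rightarrow> real) \<Rightarrow> 'a set" where
  "positivity_set u = {x. u x > 0}"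

end

theory Submission
  imports Defs
begin

text \<open>
  The functional \<open>TV\<close> is convex and homogeneous of degree one, so \<open>w \<in> \<partial>TV(u)\<close> says
  that \<open>TV(z) \<ge> \<integral>wz\<close> for every \<open>z \<in> L\<^sup>2\<close>, with equality at \<open>z = u\<close>
  (\<open>subdifferential_TV_iff\<close>). Let \<open>w = h\<xi>\<close> with \<open>\<xi> \<in> sign(u)\<close>, and put \<open>E = {u > 0}\<close>.

  For \<open>s > 0\<close> split \<open>u\<close> at the levels \<open>0\<close> and \<open>s\<close> into
  \<open>min(u, 0) + min(u\<^sup>+, s) + (u - s)\<^sup>+\<close>. All three summands are nondecreasing functions of
  \<open>u\<close>, hence \<open>TV\<close> is additive on this sum (\<open>total_variation_mono_add\<close>). Each summand
  satisfies the subgradient inequality, and the inequalities add up to an equality; so each of them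
  is an equality. In particular \<open>TV(min(u\<^sup>+, s)/s) = \<integral>w min(u\<^sup>+, s)/s \<le> h\<nu>(E)\<close>, because
  \<open>w = h\<close> on \<open>E\<close>. As \<open>s \<rightarrow> 0\<close> these functions tend pointwise to \<open>\<chi>\<^sub>E\<close>, and Fatou's
  lemma gives \<open>TV(\<chi>\<^sub>E) \<le> h\<nu>(E)\<close>; the subgradient inequality is the converse
  (\<open>total_variation_positivity_set\<close>). This takes the place of the coarea formula.

  Hence the same \<open>w\<close> is a subgradient at \<open>\<chi>\<^sub>E/\<nu>(E)\<close>. Also \<open>\<xi> \<in> sign(\<chi>\<^sub>E)\<close>, since
  \<open>\<xi> = 1\<close> on \<open>E\<close> and \<open>\<bar>\<xi>\<bar> \<le> 1\<close> elsewhere; this is the new eigenpair. Testing with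
  the constant \<open>1\<close>, whose total variation vanishes, gives \<open>\<integral>\<xi> \<le> 0\<close>, and therefore
  \<open>\<nu>(E) \<le> \<nu>(X \<setminus> E)\<close>. By reversibility \<open>TV(\<chi>\<^sub>E) = P(E)\<close>
  (\<open>total_variation_indicator\<close>), so \<open>E\<close> attains the Cheeger constant.

  A minimizer \<open>E\<close> of the Cheeger quotient is calibrable because all its subsets compete in the
  Cheeger problem. Its complement is calibrable because \<open>P(F) = P(X \<setminus> F)\<close>: for a subset
  \<open>F\<close> of \<open>X \<setminus> E\<close>, at least one of \<open>F\<close> and \<open>X \<setminus> F\<close> competes in the Cheeger problem
  (\<open>m_calibrable_Cheeger_set\<close>).
\<close>

section \<open>Integration along the random walk\<close>

lemma ennreal_double_half: "2 * c / 2 = (c :: ennreal)"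
  by (subst mult.commute) (rule ennreal_mult_divide_eq, auto)

lemma ennreal_half_double: "2 * (c / 2) = (c :: ennreal)"
  by (simp only: ennreal_times_divide ennreal_double_half)

context reversible_random_walk_space
begin

interpretation completion_nu: prob_space "completion \<nu>"
  using prob_space.prob_space_completion[OF prob_space_nu] .

lemma sets_nu [simp]: "sets \<nu> = sets borel"
  using radon_nu by (simp add: radon_measure_def)

lemma space_nu [simp]: "space \<nu> = UNIV"
  using sets_eq_imp_space_eq[OF sets_nu] by simp

lemma space_walk [simp]: "space (m x) = UNIV"
  using sets_eq_imp_space_eq[OF sets_walk] by simp

lemma Compl_sets_completion: "E \<in> sets (completion \<nu>) \<Longrightarrow> - E \<in> sets (completion \<nu>)"
  using sets.compl_sets[of E "completion \<nu>"] by (simp add: Compl_eq_Diff_UNIV)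

lemma positivity_set_measurable:
  assumes [measurable]: "u \<in> borel_measurable (completion \<nu>)"
  shows "positivity_set u \<in> sets (completion \<nu>)"
proof -
  have "{x \<in> space (completion \<nu>). 0 < u x} \<in> sets (completion \<nu>)" by measurable
  then show ?thesis by (simp add: positivity_set_def)
qed

lemma kernel_measurable: "m \<in> measurable borel (subprob_algebra borel)"
  by (intro measurable_subprob_algebra)
     (auto simp: sets_walk measurable_walk intro: prob_space_imp_subprob_space prob_space_walk)

text \<open>
  Invariance is what makes the iterated integrals insensitive to \<open>\<nu>\<close>-null sets: a \<open>\<nu>\<close>-null
  set is charged by \<open>m x\<close> only for \<open>x\<close> in another \<open>\<nu>\<close>-null set. Thus a function
  measurable for the completion of \<open>\<nu>\<close> can be replaced by a Borel representative in both
  variables at once.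
\<close>
lemma AE_walk:
  assumes "AE x in \<nu>. P x"
  shows "AE x in \<nu>. AE y in m x. P y"
proof -
  obtain N where N: "N \<in> null_sets \<nu>" "{x\<in>space \<nu>. \<not> P x} \<subseteq> N"
    using assms unfolding eventually_ae_filter by auto
  then have Nb: "N \<in> sets borel" by auto
  have [measurable]: "(\<lambda>x. emeasure (m x) N) \<in> borel_measurable \<nu>"
    using measurable_walk[OF Nb] measurable_cong_sets[OF sets_nu refl] by blast
  have "(\<integral>\<^sup>+ x. emeasure (m x) N \<partial>\<nu>) = 0"
    using invariant[OF Nb] N(1) by auto
  then have "AE x in \<nu>. emeasure (m x) N = 0"
    by (subst (asm) nn_integral_0_iff_AE) auto
  then show ?thesis
  proof eventually_elim
    case (elim x)
    then have "N \<in> null_sets (m x)" using Nb by (auto simp: sets_walk)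
    moreover have "{y \<in> space (m x). \<not> P y} \<subseteq> N" using N(2) by auto
    ultimately show ?case unfolding eventually_ae_filter by blast
  qed
qed

lemma nn_integral_walk_cong_AE:
  assumes "AE x in \<nu>. f x = g x"
  shows "(\<integral>\<^sup>+ x. \<integral>\<^sup>+ y. F (f x) (f y) \<partial>m x \<partial>\<nu>) = (\<integral>\<^sup>+ x. \<integral>\<^sup>+ y. F (g x) (g y) \<partial>m x \<partial>\<nu>)"
proof (intro nn_integral_cong_AE)
  show "AE x in \<nu>. (\<integral>\<^sup>+ y. F (f x) (f y) \<partial>m x) = (\<integral>\<^sup>+ y. F (g x) (g y) \<partial>m x)"
    using assms AE_walk[OF assms] by eventually_elim (auto intro!: nn_integral_cong_AE)
qed

lemma borel_measurable_pair:
  assumes [measurable]: "g \<in> borel_measurable borel"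
    and F: "(\<lambda>(a, b). F a b) \<in> borel_measurable (borel \<Otimes>\<^sub>M borel)"
  shows "(\<lambda>(x, y). F (g x) (g y)) \<in> borel_measurable (borel \<Otimes>\<^sub>M borel)"
proof -
  have "(\<lambda>z. (\<lambda>(a, b). F a b) (g (fst z), g (snd z))) \<in> borel_measurable (borel \<Otimes>\<^sub>M borel)"
    by (rule measurable_compose[OF _ F]) measurable
  then show ?thesis by (simp add: case_prod_beta')
qed

lemma borel_measurable_walk_integral:
  fixes F :: "real \<Rightarrow> real \<Rightarrow> ennreal"
  assumes "g \<in> borel_measurable borel"
    and "(\<lambda>(a, b). F a b) \<in> borel_measurable (borel \<Otimes>\<^sub>M borel)"
  shows "(\<lambda>x. \<integral>\<^sup>+ y. F (g x) (g y) \<partial>m x) \<in> borel_measurable \<nu>"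
    and "(\<lambda>y. F (g x) (g y)) \<in> borel_measurable (m x)"
proof -
  note F = borel_measurable_pair[OF assms]
  have "(\<lambda>x. \<integral>\<^sup>+ y. F (g x) (g y) \<partial>m x) \<in> borel_measurable borel"
    by (rule nn_integral_measurable_subprob_algebra2[OF F kernel_measurable])
  then show "(\<lambda>x. \<integral>\<^sup>+ y. F (g x) (g y) \<partial>m x) \<in> borel_measurable \<nu>"
    using measurable_cong_sets[OF sets_nu refl] by blast
  have "(\<lambda>y. (\<lambda>(x, y). F (g x) (g y)) (x, y)) \<in> borel_measurable borel"
    by (rule measurable_compose[OF measurable_Pair1' F]) simp
  then show "(\<lambda>y. F (g x) (g y)) \<in> borel_measurable (m x)"
    using measurable_cong_sets[OF sets_walk refl] by auto
qed

lemma borel_representative: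
  fixes u :: "'a \<Rightarrow> real"
  assumes "u \<in> borel_measurable (completion \<nu>)"
  obtains g where "g \<in> borel_measurable borel" "AE x in \<nu>. u x = g x"
  using completion_ex_borel_measurable_real[OF assms] measurable_cong_sets[OF sets_nu refl]
  by blast

text \<open>
  For a function \<open>u\<close> that is only \<open>\<nu>\<close>-measurable, the inner integrands may fail to be
  measurable for exceptional \<open>x\<close>; additivity is obtained from a Borel representative of \<open>u\<close>.
\<close>
lemma nn_integral_walk_add:
  fixes u :: "'a \<Rightarrow> real" and F G :: "real \<Rightarrow> real \<Rightarrow> ennreal"
  assumes u: "u \<in> borel_measurable (completion \<nu>)"
    and F: "(\<lambda>(a, b). F a b) \<in> borel_measurable (borel \<Otimes>\<^sub>M borel)"
    and G: "(\<lambda>(a, b). G a b) \<in> borel_measurable (borel \<Otimes>\<^sub>M borel)"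
  shows "(\<integral>\<^sup>+ x. \<integral>\<^sup>+ y. F (u x) (u y) + G (u x) (u y) \<partial>m x \<partial>\<nu>)
       = (\<integral>\<^sup>+ x. \<integral>\<^sup>+ y. F (u x) (u y) \<partial>m x \<partial>\<nu>) + (\<integral>\<^sup>+ x. \<integral>\<^sup>+ y. G (u x) (u y) \<partial>m x \<partial>\<nu>)"
proof -
  obtain g where g: "g \<in> borel_measurable borel" "AE x in \<nu>. u x = g x"
    using borel_representative[OF u] by blast
  note m = borel_measurable_walk_integral[OF g(1) F] borel_measurable_walk_integral[OF g(1) G]
  have "(\<integral>\<^sup>+ x. \<integral>\<^sup>+ y. F (g x) (g y) + G (g x) (g y) \<partial>m x \<partial>\<nu>)
       = (\<integral>\<^sup>+ x. \<integral>\<^sup>+ y. F (g x) (g y) \<partial>m x \<partial>\<nu>) + (\<integral>\<^sup>+ x. \<integral>\<^sup>+ y. G (g x) (g y) \<partial>m x \<partial>\<nu>)"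
    using m by (simp add: nn_integral_add)
  then show ?thesis
    using nn_integral_walk_cong_AE[OF g(2), of F] nn_integral_walk_cong_AE[OF g(2), of G]
      nn_integral_walk_cong_AE[OF g(2), of "\<lambda>a b. F a b + G a b"] by simp
qed

section \<open>The total variation\<close>

lemma total_variation_eq:
  "total_variation m \<nu> u = (\<integral>\<^sup>+ x. \<integral>\<^sup>+ y. ennreal \<bar>u y - u x\<bar> \<partial>m x \<partial>\<nu>) / 2"
  by (simp add: total_variation_def nn_integral_completion)

text \<open>
  Increments of two nondecreasing functions of the same quantity never have opposite signs, so the
  absolute values of the increments add up pointwise.
\<close>
lemma total_variation_mono_add:
  fixes p q :: "real \<Rightarrow> real"
  assumes u: "u \<in> borel_measurable (completion \<nu>)" and p: "mono p" and q: "mono q"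
  shows "total_variation m \<nu> (\<lambda>x. p (u x) + q (u x))
       = total_variation m \<nu> (\<lambda>x. p (u x)) + total_variation m \<nu> (\<lambda>x. q (u x))"
proof -
  have [measurable]: "p \<in> borel_measurable borel" "q \<in> borel_measurable borel"
    by (rule borel_measurable_mono[OF p], rule borel_measurable_mono[OF q])
  have *: "\<bar>p b + q b - (p a + q a)\<bar> = \<bar>p b - p a\<bar> + \<bar>q b - q a\<bar>" for a b
  proof (cases "a \<le> b")
    case True
    then show ?thesis using monoD[OF p True] monoD[OF q True] by simp
  next
    case False
    then have "b \<le> a" by simp
    then show ?thesis using monoD[OF p \<open>b \<le> a\<close>] monoD[OF q \<open>b \<le> a\<close>] by simp
  qed
  show ?thesis
    unfolding total_variation_eq * ennreal_plus[OF abs_ge_zero abs_ge_zero]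
    by (subst nn_integral_walk_add[OF u, of "\<lambda>a b. ennreal \<bar>p b - p a\<bar>" "\<lambda>a b. ennreal \<bar>q b - q a\<bar>"])
       (auto simp: add_divide_distrib_ennreal)
qed

lemma total_variation_scale:
  assumes u: "u \<in> borel_measurable (completion \<nu>)" and c: "0 \<le> c"
  shows "total_variation m \<nu> (\<lambda>x. c * u x) = ennreal c * total_variation m \<nu> u"
proof -
  obtain g where g: "g \<in> borel_measurable borel" "AE x in \<nu>. u x = g x"
    using borel_representative[OF u] by blast
  have F: "(\<lambda>(a, b). ennreal \<bar>b - a :: real\<bar>) \<in> borel_measurable (borel \<Otimes>\<^sub>M borel)"
    by measurable
  note m = borel_measurable_walk_integral[OF g(1) F]
  have "ennreal \<bar>c * b - c * a\<bar> = ennreal c * ennreal \<bar>b - a\<bar>" for a b :: real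
    using c by (simp add: ennreal_mult'[symmetric] abs_mult right_diff_distrib[symmetric])
  then have "(\<integral>\<^sup>+ x. \<integral>\<^sup>+ y. ennreal \<bar>c * g y - c * g x\<bar> \<partial>m x \<partial>\<nu>)
       = ennreal c * (\<integral>\<^sup>+ x. \<integral>\<^sup>+ y. ennreal \<bar>g y - g x\<bar> \<partial>m x \<partial>\<nu>)"
    using m by (simp add: nn_integral_cmult)
  then show ?thesis
    unfolding total_variation_eq
    using nn_integral_walk_cong_AE[OF g(2), of "\<lambda>a b. ennreal \<bar>b - a\<bar>"]
      nn_integral_walk_cong_AE[OF g(2), of "\<lambda>a b. ennreal \<bar>c * b - c * a\<bar>"]
    by (simp add: ennreal_times_divide)
qed

text \<open>
  Lower semicontinuity under pointwise convergence: Fatou's lemma, once in each variable.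
\<close>
lemma total_variation_le_of_tendsto:
  fixes f :: "nat \<Rightarrow> 'a \<Rightarrow> real"
  assumes f: "\<And>n. f n \<in> borel_measurable (completion \<nu>)"
    and lim: "\<And>x. (\<lambda>n. f n x) \<longlonglongrightarrow> v x"
    and le: "\<And>n. total_variation m \<nu> (f n) \<le> c"
  shows "total_variation m \<nu> v \<le> c"
proof -
  have "\<exists>g. g \<in> borel_measurable borel \<and> (AE x in \<nu>. f n x = g x)" for n
    using borel_representative[OF f[of n]] by blast
  then have "\<exists>g. \<forall>n. g n \<in> borel_measurable borel \<and> (AE x in \<nu>. f n x = g n x)"
    by (intro choice) blast
  then obtain g where g: "\<And>n. g n \<in> borel_measurable borel" "\<And>n. AE x in \<nu>. f n x = g n x"
    by blast
  let ?F = "\<lambda>a b :: real. ennreal \<bar>b - a\<bar>"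
  have F: "(\<lambda>(a, b). ?F a b) \<in> borel_measurable (borel \<Otimes>\<^sub>M borel)"
    by measurable
  note meas = borel_measurable_walk_integral[OF g(1) F]
  have "AE x in \<nu>. \<forall>n. f n x = g n x" using g(2) by (simp add: AE_all_countable)
  then have conv: "AE x in \<nu>. (\<lambda>n. g n x) \<longlonglongrightarrow> v x"
  proof eventually_elim
    case (elim x)
    then show ?case using lim[of x] by simp
  qed
  have inner: "AE x in \<nu>. (\<integral>\<^sup>+ y. ?F (v x) (v y) \<partial>m x)
      \<le> liminf (\<lambda>n. \<integral>\<^sup>+ y. ?F (g n x) (g n y) \<partial>m x)"
    using conv AE_walk[OF conv]
  proof eventually_elim
    case (elim x)
    have "AE y in m x. ?F (v x) (v y) = liminf (\<lambda>n. ?F (g n x) (g n y))"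
      using elim(2)
    proof eventually_elim
      case (elim y)
      have "(\<lambda>n. ?F (g n x) (g n y)) \<longlonglongrightarrow> ?F (v x) (v y)"
        using elim \<open>(\<lambda>n. g n x) \<longlonglongrightarrow> v x\<close> by (intro tendsto_intros)
      then show ?case using lim_imp_Liminf[OF sequentially_bot] by metis
    qed
    then have "(\<integral>\<^sup>+ y. ?F (v x) (v y) \<partial>m x) = (\<integral>\<^sup>+ y. liminf (\<lambda>n. ?F (g n x) (g n y)) \<partial>m x)"
      by (rule nn_integral_cong_AE)
    also have "\<dots> \<le> liminf (\<lambda>n. \<integral>\<^sup>+ y. ?F (g n x) (g n y) \<partial>m x)"
      using meas(2) by (rule nn_integral_liminf)
    finally show ?case .
  qed
  have "total_variation m \<nu> v \<le> (\<integral>\<^sup>+ x. liminf (\<lambda>n. \<integral>\<^sup>+ y. ?F (g n x) (g n y) \<partial>m x) \<partial>\<nu>) / 2"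
    unfolding total_variation_eq by (intro divide_right_mono_ennreal nn_integral_mono_AE inner)
  also have "\<dots> \<le> liminf (\<lambda>n. \<integral>\<^sup>+ x. \<integral>\<^sup>+ y. ?F (g n x) (g n y) \<partial>m x \<partial>\<nu>) / 2"
    using meas(1) by (intro divide_right_mono_ennreal nn_integral_liminf)
  also have "\<dots> \<le> (2 * c) / 2"
  proof (intro divide_right_mono_ennreal)
    have "(\<integral>\<^sup>+ x. \<integral>\<^sup>+ y. ?F (g n x) (g n y) \<partial>m x \<partial>\<nu>) \<le> 2 * c" for n
    proof -
      have "(\<integral>\<^sup>+ x. \<integral>\<^sup>+ y. ?F (g n x) (g n y) \<partial>m x \<partial>\<nu>) = 2 * total_variation m \<nu> (f n)"
        unfolding total_variation_eq nn_integral_walk_cong_AE[OF g(2), of ?F]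
        by (rule ennreal_half_double[symmetric])
      then show ?thesis using le[of n] by (simp add: mult_left_mono)
    qed
    then show "liminf (\<lambda>n. \<integral>\<^sup>+ x. \<integral>\<^sup>+ y. ?F (g n x) (g n y) \<partial>m x \<partial>\<nu>) \<le> 2 * c"
      by (intro Liminf_le) auto
  qed
  also have "\<dots> = c"
    by (rule ennreal_double_half)
  finally show ?thesis .
qed

section \<open>Interaction and perimeter\<close>

text \<open>
  For almost every \<open>x\<close> the value \<open>emeasure (completion (m x)) B\<close> is thus a genuine measure
  rather than the default value \<open>0\<close> for sets that are not measurable.
\<close>
lemma AE_completion_sets_walk:
  assumes "B \<in> sets (completion \<nu>)"
  shows "AE x in \<nu>. B \<in> sets (completion (m x))"
proof -
  obtain S N N' where B: "B = S \<union> N" "N \<subseteq> N'" "N' \<in> null_sets \<nu>" "S \<in> sets \<nu>"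
    using sets_completionE[OF assms] by blast
  have "AE x in \<nu>. AE y in m x. y \<notin> N'"
    using AE_walk[OF AE_not_in[OF B(3)]] .
  then show ?thesis
  proof eventually_elim
    case (elim x)
    have "N' \<in> sets (m x)" using B(3) by (auto simp: sets_walk)
    then have "N' \<in> null_sets (m x)" using elim by (simp add: AE_iff_null_sets)
    then show ?case using B by (intro sets_completionI[of B S N N']) (auto simp: sets_walk)
  qed
qed

lemma m_interaction_eq:
  assumes "B \<in> sets (completion \<nu>)"
  shows "m_interaction m \<nu> A B = (\<integral>\<^sup>+ x. \<integral>\<^sup>+ y. indicator A x * indicator B y \<partial>m x \<partial>\<nu>)"
  unfolding m_interaction_def nn_integral_completion
proof (intro nn_integral_cong_AE)
  show "AE x in \<nu>. indicator A x * emeasure (completion (m x)) B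
      = (\<integral>\<^sup>+ y. indicator A x * indicator B y \<partial>m x)"
    using AE_completion_sets_walk[OF assms]
  proof eventually_elim
    case (elim x)
    have "emeasure (completion (m x)) B = (\<integral>\<^sup>+ y. indicator B y \<partial>m x)"
      using nn_integral_indicator[OF elim] by (simp add: nn_integral_completion)
    then show ?case by (cases "x \<in> A") auto
  qed
qed

text \<open>
  Reversibility, applied to the product of Borel versions of \<open>A\<close> and \<open>B\<close>.
\<close>
lemma m_interaction_commute:
  assumes A: "A \<in> sets (completion \<nu>)" and B: "B \<in> sets (completion \<nu>)"
  shows "m_interaction m \<nu> A B = m_interaction m \<nu> B A"
proof -
  obtain S M M' where S: "A = S \<union> M" "M \<subseteq> M'" "M' \<in> null_sets \<nu>" "S \<in> sets \<nu>"
    using sets_completionE[OF A] by blast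
  obtain T N N' where T: "B = T \<union> N" "N \<subseteq> N'" "N' \<in> null_sets \<nu>" "T \<in> sets \<nu>"
    using sets_completionE[OF B] by blast
  have "AE x in \<nu>. (x \<in> A, x \<in> B) = (x \<in> S, x \<in> T)"
    using AE_not_in[OF S(3)] AE_not_in[OF T(3)] by eventually_elim (use S T in auto)
  (* A and B are replaced simultaneously: the congruence is applied to the pair of their
     membership predicates. *)
  note cong = nn_integral_walk_cong_AE[OF this]
  have "(\<integral>\<^sup>+ x. \<integral>\<^sup>+ y. of_bool (x \<in> A) * of_bool (y \<in> B) \<partial>m x \<partial>\<nu>)
      = (\<integral>\<^sup>+ x. \<integral>\<^sup>+ y. of_bool (x \<in> S) * of_bool (y \<in> T) \<partial>m x \<partial>\<nu>)"
    using cong[of "\<lambda>a b. of_bool (fst a) * of_bool (snd b)"] unfolding fst_conv snd_conv .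
  then have 1: "m_interaction m \<nu> A B = (\<integral>\<^sup>+ x. \<integral>\<^sup>+ y. indicator (S \<times> T) (x, y) \<partial>m x \<partial>\<nu>)"
    unfolding m_interaction_eq[OF B] indicator_times fst_conv snd_conv by (simp only: indicator_def)
  have "(\<integral>\<^sup>+ x. \<integral>\<^sup>+ y. of_bool (y \<in> A) * of_bool (x \<in> B) \<partial>m x \<partial>\<nu>)
      = (\<integral>\<^sup>+ x. \<integral>\<^sup>+ y. of_bool (y \<in> S) * of_bool (x \<in> T) \<partial>m x \<partial>\<nu>)"
    using cong[of "\<lambda>a b. of_bool (fst b) * of_bool (snd a)"] unfolding fst_conv snd_conv .
  then have 2: "m_interaction m \<nu> B A = (\<integral>\<^sup>+ x. \<integral>\<^sup>+ y. indicator (S \<times> T) (y, x) \<partial>m x \<partial>\<nu>)"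
    unfolding m_interaction_eq[OF A] indicator_times fst_conv snd_conv
    by (simp only: indicator_def mult.commute)
  have "S \<times> T \<in> sets borel"
    unfolding borel_prod[symmetric] using S T by auto
  from reversible[OF this] show ?thesis unfolding 1 2 .
qed

text \<open>
  The integrand \<open>\<bar>\<chi>\<^sub>E(y) - \<chi>\<^sub>E(x)\<bar>\<close> counts the transitions from \<open>E\<close> to its
  complement and those in the opposite direction. By reversibility both contribute \<open>P(E)\<close>, which
  compensates the factor \<open>1/2\<close> in the definition of \<open>TV\<close>.
\<close>
lemma total_variation_indicator:
  assumes E: "E \<in> sets (completion \<nu>)"
  shows "total_variation m \<nu> (indicator E) = m_perimeter m \<nu> E"
proof -
  have Ec: "- E \<in> sets (completion \<nu>)" by (rule Compl_sets_completion[OF E])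
  have iE: "(indicator E :: 'a \<Rightarrow> real) \<in> borel_measurable (completion \<nu>)"
    using E by simp
  have "(\<integral>\<^sup>+ x. \<integral>\<^sup>+ y. ennreal \<bar>indicator E y - indicator E x\<bar> \<partial>m x \<partial>\<nu>)
      = (\<integral>\<^sup>+ x. \<integral>\<^sup>+ y. ennreal (indicator E x * (1 - indicator E y))
          + ennreal ((1 - indicator E x) * indicator E y) \<partial>m x \<partial>\<nu>)"
    by (intro nn_integral_cong) (auto simp: indicator_def)
  also have "\<dots> = (\<integral>\<^sup>+ x. \<integral>\<^sup>+ y. ennreal (indicator E x * (1 - indicator E y)) \<partial>m x \<partial>\<nu>)
      + (\<integral>\<^sup>+ x. \<integral>\<^sup>+ y. ennreal ((1 - indicator E x) * indicator E y) \<partial>m x \<partial>\<nu>)"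
    by (rule nn_integral_walk_add[OF iE]) measurable
  also have "\<dots> = m_interaction m \<nu> E (- E) + m_interaction m \<nu> (- E) E"
    unfolding m_interaction_eq[OF E] m_interaction_eq[OF Ec]
    by (intro arg_cong2[where f = "(+)"] nn_integral_cong) (auto simp: indicator_def)
  also have "\<dots> = 2 * m_perimeter m \<nu> E"
    using m_interaction_commute[OF E Ec] by (simp add: m_perimeter_def mult_2)
  finally show ?thesis
    by (simp add: total_variation_eq ennreal_double_half)
qed

lemma m_perimeter_Compl:
  assumes E: "E \<in> sets (completion \<nu>)"
  shows "m_perimeter m \<nu> (- E) = m_perimeter m \<nu> E"
  using m_interaction_commute[OF E Compl_sets_completion[OF E]] by (simp add: m_perimeter_def)

section \<open>Subgradients\<close>

lemma L2I_bounded_by: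
  assumes u: "u \<in> L2 \<nu>" and v: "v \<in> borel_measurable (completion \<nu>)" and le: "\<And>x. \<bar>v x\<bar> \<le> \<bar>u x\<bar>"
  shows "v \<in> L2 \<nu>"
proof -
  have "integrable (completion \<nu>) (\<lambda>x. (u x)\<^sup>2)" using u by (simp add: L2_def)
  then have "integrable (completion \<nu>) (\<lambda>x. (v x)\<^sup>2)"
  proof (rule Bochner_Integration.integrable_bound)
    show "(\<lambda>x. (v x)\<^sup>2) \<in> borel_measurable (completion \<nu>)" using v by measurable
    show "AE x in completion \<nu>. norm ((v x)\<^sup>2) \<le> norm ((u x)\<^sup>2)"
      using le by (simp add: abs_le_square_iff)
  qed
  then show ?thesis using v by (simp add: L2_def)
qed

lemma L2_const: "(\<lambda>x. c) \<in> L2 \<nu>"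
proof -
  show ?thesis by (simp add: L2_def)
qed

lemma L2_scale: "u \<in> L2 \<nu> \<Longrightarrow> (\<lambda>x. c * u x) \<in> L2 \<nu>"
  by (auto simp: L2_def power_mult_distrib)

lemma L2_indicator: "E \<in> sets (completion \<nu>) \<Longrightarrow> indicator E \<in> L2 \<nu>"
  by (rule L2I_bounded_by[OF L2_const[of 1]]) (auto simp: indicator_def)

lemma integrable_mult_L2:
  assumes u: "u \<in> L2 \<nu>" and v: "v \<in> L2 \<nu>"
  shows "integrable (completion \<nu>) (\<lambda>x. u x * v x)"
proof -
  have "integrable (completion \<nu>) (\<lambda>x. (u x)\<^sup>2 + (v x)\<^sup>2)"
    using u v by (simp add: L2_def)
  then show ?thesis
  proof (rule Bochner_Integration.integrable_bound)
    show "(\<lambda>x. u x * v x) \<in> borel_measurable (completion \<nu>)"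
      using u v by (auto simp: L2_def)
    have "\<bar>u x * v x\<bar> \<le> (u x)\<^sup>2 + (v x)\<^sup>2" for x
    proof -
      have "0 \<le> (\<bar>u x\<bar> - \<bar>v x\<bar>)\<^sup>2" by simp
      then have "2 * (\<bar>u x\<bar> * \<bar>v x\<bar>) \<le> (u x)\<^sup>2 + (v x)\<^sup>2"
        by (simp add: power2_diff)
      moreover have "0 \<le> \<bar>u x\<bar> * \<bar>v x\<bar>" by simp
      ultimately show ?thesis unfolding abs_mult by linarith
    qed
    then show "AE x in completion \<nu>. norm (u x * v x) \<le> norm ((u x)\<^sup>2 + (v x)\<^sup>2)"
      by simp
  qed
qed

text \<open>
  Euler's identity for a functional that is homogeneous of degree one: testing with \<open>z = 0\<close> and
  \<open>z = 2u\<close> bounds \<open>TV(u)\<close> by \<open>\<integral>wu\<close> from above and from below, and then the term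
  \<open>TV(u) - \<integral>wu\<close> drops out of the subgradient inequality. Truncating the integrals with
  \<open>ennreal\<close> loses nothing: where \<open>\<integral>wz\<close> is negative the inequality is trivial, and testing
  with \<open>-u\<close> shows that \<open>\<integral>wu\<close> is not negative.
\<close>
lemma subdifferential_TV_iff:
  "w \<in> subdifferential_TV m \<nu> u \<longleftrightarrow>
     w \<in> L2 \<nu> \<and> u \<in> L2 \<nu> \<and> total_variation m \<nu> u = ennreal (\<integral>x. w x * u x \<partial>completion \<nu>) \<and>
     (\<forall>z\<in>L2 \<nu>. ennreal (\<integral>x. w x * z x \<partial>completion \<nu>) \<le> total_variation m \<nu> z)"
  (is "?sub \<longleftrightarrow> ?R")
proof
  let ?I = "\<lambda>z. \<integral>x. w x * z x \<partial>completion \<nu>"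
  have diff: "(\<integral>x. w x * (z x - y x) \<partial>completion \<nu>) = ?I z - ?I y"
    if "w \<in> L2 \<nu>" "z \<in> L2 \<nu>" "y \<in> L2 \<nu>" for y z
    using integrable_mult_L2[OF that(1,2)] integrable_mult_L2[OF that(1,3)]
    by (simp add: right_diff_distrib)
  {
    assume ?sub
    then have w: "w \<in> L2 \<nu>" and u: "u \<in> L2 \<nu>" and fin: "total_variation m \<nu> u < \<infinity>"
      and sub: "\<And>z. z \<in> L2 \<nu> \<Longrightarrow> enn2ereal (total_variation m \<nu> u) + ereal (?I z - ?I u)
          \<le> enn2ereal (total_variation m \<nu> z)"
      using diff by (auto simp: subdifferential_TV_def)
    have um: "u \<in> borel_measurable (completion \<nu>)" using u by (simp add: L2_def)
    obtain T where T: "0 \<le> T" "total_variation m \<nu> u = ennreal T"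
      using fin by (cases "total_variation m \<nu> u") auto
    have "T + (0 * ?I u - ?I u) \<le> 0 * T" "T + (2 * ?I u - ?I u) \<le> 2 * T"
    proof -
      have "T + (c * ?I u - ?I u) \<le> c * T" if "0 \<le> c" for c
      proof -
        have "?I (\<lambda>x. c * u x) = c * ?I u"
          by (simp add: mult.left_commute)
        then show ?thesis
          using sub[OF L2_scale[OF u, of c]] T \<open>0 \<le> c\<close>
          by (simp add: total_variation_scale[OF um] ennreal_mult[symmetric])
      qed
      from this[of 0] this[of 2] show "T + (0 * ?I u - ?I u) \<le> 0 * T" "T + (2 * ?I u - ?I u) \<le> 2 * T"
        by simp_all
    qed
    then have eq: "T = ?I u" by simp
    have "ennreal (?I z) \<le> total_variation m \<nu> z" if "z \<in> L2 \<nu>" for z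
    proof (cases "total_variation m \<nu> z")
      case (real t)
      then show ?thesis using sub[OF that] T eq by (simp add: ennreal_leI)
    qed simp
    then show ?R using w u T eq by simp
  }
  {
    assume R: ?R
    then have w: "w \<in> L2 \<nu>" and u: "u \<in> L2 \<nu>" and T: "total_variation m \<nu> u = ennreal (?I u)"
      by auto
    have "ennreal (?I (\<lambda>x. - 1 * u x)) \<le> total_variation m \<nu> (\<lambda>x. - 1 * u x)"
      using R[THEN conjunct2, THEN conjunct2, THEN conjunct2, rule_format, OF L2_scale[OF u, of "- 1"]] .
    also have "\<dots> = total_variation m \<nu> u"
      by (simp add: total_variation_eq abs_minus_commute)
    finally have pos: "0 \<le> ?I u"
      using T by (cases "0 \<le> ?I u") (auto simp: ennreal_neg)
    have "enn2ereal (total_variation m \<nu> u) + ereal (\<integral>x. w x * (z x - u x) \<partial>completion \<nu>)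
        \<le> enn2ereal (total_variation m \<nu> z)" if z: "z \<in> L2 \<nu>" for z
    proof (cases "total_variation m \<nu> z")
      case (real t)
      have "ennreal (?I z) \<le> total_variation m \<nu> z" using R z by blast
      then show ?thesis using real T pos diff[OF w z u] by (auto simp: ennreal_le_iff)
    next
      case top
      then show ?thesis by simp
    qed
    then show ?sub using w u T by (simp add: subdifferential_TV_def)
  }
qed

text \<open>
  The subgradient inequality, an equality at \<open>u\<close>, passes to the superlevel set \<open>{u > 0}\<close>. The
  truncations \<open>min(u\<^sup>+, s)\<close> inherit the equality because \<open>TV\<close> is additive on the three
  layers of \<open>u\<close>; rescaled by \<open>1/s\<close> they approximate the indicator of \<open>{u > 0}\<close>.
\<close>
lemma total_variation_positivity_set:
  assumes w: "w \<in> subdifferential_TV m \<nu> u"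
    and pos: "\<And>x. 0 < u x \<Longrightarrow> w x = h" and h: "0 \<le> h"
  shows "total_variation m \<nu> (indicator (positivity_set u))
       = ennreal (h * measure (completion \<nu>) (positivity_set u))"
proof -
  let ?E = "positivity_set u" and ?TV = "total_variation m \<nu>"
  let ?I = "\<lambda>z. \<integral>x. w x * z x \<partial>completion \<nu>"
  have wL: "w \<in> L2 \<nu>" and u: "u \<in> L2 \<nu>" and TVu: "?TV u = ennreal (?I u)"
    and sub: "\<And>z. z \<in> L2 \<nu> \<Longrightarrow> ennreal (?I z) \<le> ?TV z"
    using w by (auto simp: subdifferential_TV_iff)
  have um [measurable]: "u \<in> borel_measurable (completion \<nu>)" using u by (simp add: L2_def)
  have E [measurable]: "?E \<in> sets (completion \<nu>)"
    by (rule positivity_set_measurable[OF um])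
  have IE: "?I (indicator ?E) = h * measure (completion \<nu>) ?E"
  proof -
    have "?I (indicator ?E) = (\<integral>x. h * indicator ?E x \<partial>completion \<nu>)"
      by (rule Bochner_Integration.integral_cong) (auto simp: indicator_def positivity_set_def pos)
    then show ?thesis by simp
  qed
  have EL: "(indicator ?E :: 'a \<Rightarrow> real) \<in> L2 \<nu>" by (rule L2_indicator[OF E])
  have clip: "?TV (\<lambda>x. min (max (u x) 0) s) \<le> ennreal (?I (\<lambda>x. min (max (u x) 0) s))"
    if s: "0 < s" for s
  proof -
    let ?a = "\<lambda>t :: real. min t 0" and ?b = "\<lambda>t :: real. min (max t 0) s" and ?c = "\<lambda>t :: real. max (t - s) 0"
    have L: "(\<lambda>x. ?a (u x)) \<in> L2 \<nu>" "(\<lambda>x. ?b (u x)) \<in> L2 \<nu>" "(\<lambda>x. ?c (u x)) \<in> L2 \<nu>"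
      using s by (auto intro!: L2I_bounded_by[OF u])
    have split: "u x = ?a (u x) + (?b (u x) + ?c (u x))" for x
      using s by (auto simp: min_def max_def)
    have mono: "mono ?a" "mono ?b" "mono ?c" "mono (\<lambda>t. ?b t + ?c t)"
      using s by (auto intro!: monoI simp: min_def max_def)
    have "?TV u = ?TV (\<lambda>x. ?a (u x) + (?b (u x) + ?c (u x)))"
      by (simp only: split[symmetric])
    also have "\<dots> = ?TV (\<lambda>x. ?a (u x)) + (?TV (\<lambda>x. ?b (u x)) + ?TV (\<lambda>x. ?c (u x)))"
      using total_variation_mono_add[OF um mono(1,4)] total_variation_mono_add[OF um mono(2,3)] by simp
    finally have TV: "?TV (\<lambda>x. ?a (u x)) + (?TV (\<lambda>x. ?b (u x)) + ?TV (\<lambda>x. ?c (u x))) = ?TV u" ..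
    have "?I u = ?I (\<lambda>x. ?a (u x) + (?b (u x) + ?c (u x)))"
      by (simp only: split[symmetric])
    also have "\<dots> = ?I (\<lambda>x. ?a (u x)) + (?I (\<lambda>x. ?b (u x)) + ?I (\<lambda>x. ?c (u x)))"
      using integrable_mult_L2[OF wL L(1)] integrable_mult_L2[OF wL L(2)] integrable_mult_L2[OF wL L(3)]
      by (simp add: distrib_left)
    finally have I: "?I u = ?I (\<lambda>x. ?a (u x)) + (?I (\<lambda>x. ?b (u x)) + ?I (\<lambda>x. ?c (u x)))" .
    have "?TV (\<lambda>x. ?a (u x)) < top" "?TV (\<lambda>x. ?b (u x)) < top" "?TV (\<lambda>x. ?c (u x)) < top"
      using TV TVu by (metis ennreal_add_less_top ennreal_less_top)+
    then obtain A B C where ABC: "?TV (\<lambda>x. ?a (u x)) = ennreal A" "?TV (\<lambda>x. ?b (u x)) = ennreal B"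
        "?TV (\<lambda>x. ?c (u x)) = ennreal C" "0 \<le> A" "0 \<le> B" "0 \<le> C"
      by (metis less_top_ennreal)
    (* The inequality is used for the outer layers only; the equality at u reverses it for the
       middle layer. *)
    have le: "?I (\<lambda>x. ?a (u x)) \<le> A" "?I (\<lambda>x. ?c (u x)) \<le> C"
      using sub[OF L(1)] sub[OF L(3)] ABC by (simp_all add: ennreal_le_iff)
    have "ennreal (A + (B + C)) = ennreal (?I u)"
      using TV TVu ABC by simp
    (* The second case covers a negative integral, which ennreal truncates to 0. *)
    then have "A + (B + C) = ?I u \<or> A + (B + C) = 0"
      using ABC(4-6)
      by (cases "0 \<le> ?I u") (simp_all add: ennreal_neg ennreal_inj ennreal_eq_0_iff del: ennreal_plus)
    then have "B \<le> ?I (\<lambda>x. ?b (u x)) \<or> B = 0"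
      using le I ABC by linarith
    then show ?thesis using ABC by (auto intro: ennreal_leI)
  qed
  have "?TV (indicator ?E) \<le> ennreal (h * measure (completion \<nu>) ?E)"
  proof (rule total_variation_le_of_tendsto)
    (* Truncation at the level s = 1 / Suc n, divided by s. *)
    let ?f = "\<lambda>n x. real (Suc n) * min (max (u x) 0) (1 / real (Suc n))"
    show "?f n \<in> borel_measurable (completion \<nu>)" for n by measurable
    show "(\<lambda>n. ?f n x) \<longlonglongrightarrow> indicator ?E x" for x
    proof (cases "0 < u x")
      case True
      then have "\<forall>\<^sub>F n in sequentially. inverse (real (Suc n)) < u x"
        using order_tendstoD(2)[OF LIMSEQ_inverse_real_of_nat] by blast
      then have "\<forall>\<^sub>F n in sequentially. ?f n x = 1"
        by eventually_elim (use True in \<open>simp add: min_def inverse_eq_divide\<close>)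
      then show ?thesis using True
        by (auto simp: positivity_set_def intro!: tendsto_eventually)
    next
      case False
      then show ?thesis by (simp add: positivity_set_def max_def)
    qed
    fix n
    let ?b = "\<lambda>x. min (max (u x) 0) (1 / real (Suc n))"
    have bL: "?b \<in> L2 \<nu>" by (rule L2I_bounded_by[OF u]) auto
    have "?TV (?f n) = ennreal (real (Suc n)) * ?TV ?b"
      by (rule total_variation_scale) auto
    also have "\<dots> \<le> ennreal (real (Suc n)) * ennreal (?I ?b)"
      by (intro mult_left_mono clip) auto
    also have "\<dots> = ennreal (real (Suc n) * ?I ?b)"
      by (rule ennreal_mult'[symmetric]) simp
    also have "\<dots> = ennreal (?I (?f n))"
      by (simp only: mult.left_commute[of "w _"] integral_mult_right_zero)
    also have "\<dots> \<le> ennreal (?I (indicator ?E))"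
    proof (intro ennreal_leI integral_mono)
      show "integrable (completion \<nu>) (\<lambda>x. w x * ?f n x)"
        by (rule integrable_mult_L2[OF wL L2_scale[OF bL]])
      show "integrable (completion \<nu>) (\<lambda>x. w x * indicator ?E x)"
        by (rule integrable_mult_L2[OF wL EL])
      show "w x * ?f n x \<le> w x * indicator ?E x" for x
      proof (cases "0 < u x")
        case True
        have "?f n x \<le> real (Suc n) * (1 / real (Suc n))"
          by (intro mult_left_mono) auto
        then have "?f n x \<le> 1" by simp
        then show ?thesis
          using True h by (simp add: pos positivity_set_def mult_left_le del: of_nat_Suc)
      next
        case False
        then show ?thesis by (simp add: positivity_set_def max_def)
      qed
    qed
    finally show "?TV (?f n) \<le> ennreal (h * measure (completion \<nu>) ?E)"
      unfolding IE .
  qed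
  moreover have "ennreal (h * measure (completion \<nu>) ?E) \<le> ?TV (indicator ?E)"
    using sub[OF EL] unfolding IE .
  ultimately show ?thesis by (rule antisym)
qed

section \<open>Calibrability and the Cheeger constant\<close>

lemma ennreal_le_m_ratio_iff:
  assumes "0 < measure (completion \<nu>) E" "0 \<le> c"
  shows "ennreal c \<le> m_ratio m \<nu> E \<longleftrightarrow> ennreal (c * measure (completion \<nu>) E) \<le> m_perimeter m \<nu> E"
proof -
  let ?e = "measure (completion \<nu>) E"
  have "ennreal c * ennreal ?e \<le> m_perimeter m \<nu> E" if "ennreal c \<le> m_ratio m \<nu> E"
  proof -
    have "ennreal c * ennreal ?e \<le> m_perimeter m \<nu> E / ennreal ?e * ennreal ?e"
      using that by (intro mult_right_mono) (auto simp: m_ratio_def completion_nu.emeasure_eq_measure)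
    also have "\<dots> = m_perimeter m \<nu> E"
      using assms by (simp add: ennreal_divide_times ennreal_mult_divide_eq)
    finally show ?thesis .
  qed
  moreover have "ennreal c \<le> m_ratio m \<nu> E" if "ennreal c * ennreal ?e \<le> m_perimeter m \<nu> E"
  proof -
    have "ennreal c = ennreal c * ennreal ?e / ennreal ?e"
      using assms by (intro ennreal_mult_divide_eq[symmetric]) auto
    also have "\<dots> \<le> m_perimeter m \<nu> E / ennreal ?e"
      using that by (rule divide_right_mono_ennreal)
    finally show ?thesis by (simp add: m_ratio_def completion_nu.emeasure_eq_measure)
  qed
  ultimately show ?thesis using assms by (auto simp: ennreal_mult)
qed

lemma m_ratio_eq:
  assumes "m_perimeter m \<nu> E = ennreal c" "0 < measure (completion \<nu>) E" "0 \<le> c"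
  shows "m_ratio m \<nu> E = ennreal (c / measure (completion \<nu>) E)"
  using assms by (simp add: m_ratio_def completion_nu.emeasure_eq_measure divide_ennreal)

lemma m_calibrableI:
  assumes D: "D \<in> sets (completion \<nu>)" and D_pos: "0 < measure (completion \<nu>) D"
    and D_less: "measure (completion \<nu>) D < 1"
    and c: "0 \<le> c" and P: "m_perimeter m \<nu> D = ennreal (c * measure (completion \<nu>) D)"
    and le: "\<And>E. E \<in> sets (completion \<nu>) \<Longrightarrow> E \<subseteq> D \<Longrightarrow>
      ennreal (c * measure (completion \<nu>) E) \<le> m_perimeter m \<nu> E"
  shows "m_calibrable m \<nu> D"
proof -
  let ?S = "{E \<in> sets (completion \<nu>). E \<subseteq> D \<and> 0 < emeasure (completion \<nu>) E}"
  have ratio: "m_ratio m \<nu> D = ennreal c"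
    using m_ratio_eq[OF P D_pos] c D_pos by simp
  have "m_ratio m \<nu> D = (INF E\<in>?S. m_ratio m \<nu> E)"
  proof (rule antisym)
    show "m_ratio m \<nu> D \<le> (INF E\<in>?S. m_ratio m \<nu> E)"
    proof (rule INF_greatest)
      fix E assume "E \<in> ?S"
      then show "m_ratio m \<nu> D \<le> m_ratio m \<nu> E"
        unfolding ratio using le c
        by (subst ennreal_le_m_ratio_iff) (auto simp: completion_nu.emeasure_eq_measure)
    qed
    show "(INF E\<in>?S. m_ratio m \<nu> E) \<le> m_ratio m \<nu> D"
      using D D_pos by (intro INF_lower) (simp add: completion_nu.emeasure_eq_measure del: emeasure_completion)
  qed
  then show ?thesis
    using D D_pos D_less by (simp add: m_calibrable_def completion_nu.emeasure_eq_measure ennreal_less_one_iff del: emeasure_completion)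
qed

lemma cheeger_inequality:
  assumes "m_cheeger_constant m \<nu> = ennreal h" "0 \<le> h" and E: "E \<in> sets (completion \<nu>)"
    and half: "measure (completion \<nu>) E \<le> 1 / 2"
  shows "ennreal (h * measure (completion \<nu>) E) \<le> m_perimeter m \<nu> E"
proof (cases "measure (completion \<nu>) E = 0")
  case False
  then have pos: "0 < measure (completion \<nu>) E" by (simp add: zero_less_measure_iff)
  have "ennreal h \<le> m_ratio m \<nu> E"
    unfolding assms(1)[symmetric] m_cheeger_constant_def using E half pos by (intro INF_lower) simp
  then show ?thesis using pos assms(2) by (simp add: ennreal_le_m_ratio_iff)
qed simp

text \<open>
  Subsets of \<open>E\<close> have measure at most \<open>1/2\<close>, so the Cheeger inequality applies to them. A subset
  \<open>F\<close> of the complement is tested directly if \<open>\<nu>(F) \<le> 1/2\<close>; otherwise \<open>X \<setminus> F\<close>, which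
  contains \<open>E\<close> and has the same perimeter as \<open>F\<close>, is tested instead.
\<close>
lemma m_calibrable_Cheeger_set:
  assumes Cheeger: "m_cheeger_constant m \<nu> = ennreal h" and h: "0 \<le> h"
    and E: "E \<in> sets (completion \<nu>)"
    and E_pos: "0 < measure (completion \<nu>) E" and E_half: "measure (completion \<nu>) E \<le> 1 / 2"
    and P: "m_perimeter m \<nu> E = ennreal (h * measure (completion \<nu>) E)"
  shows "m_calibrable m \<nu> E" and "m_calibrable m \<nu> (- E)"
proof -
  let ?\<mu> = "measure (completion \<nu>)"
  define e where "e = ?\<mu> E"
  have e: "0 < e" and half: "e \<le> 1 / 2" and PE: "m_perimeter m \<nu> E = ennreal (h * e)"
    using E_pos E_half P by (simp_all add: e_def)
  have Ec: "- E \<in> sets (completion \<nu>)" by (rule Compl_sets_completion[OF E])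
  have compl: "?\<mu> (- A) = 1 - ?\<mu> A" if "A \<in> sets (completion \<nu>)" for A
    using completion_nu.prob_compl[OF that] by (simp add: Compl_eq_Diff_UNIV)
  have cheeger: "ennreal (h * ?\<mu> F) \<le> m_perimeter m \<nu> F"
    if "F \<in> sets (completion \<nu>)" "?\<mu> F \<le> 1 / 2" for F
    using cheeger_inequality[OF Cheeger _ that] h by simp
  show "m_calibrable m \<nu> E"
  proof (rule m_calibrableI[where c = h])
    fix F assume F: "F \<in> sets (completion \<nu>)" "F \<subseteq> E"
    have "?\<mu> F \<le> e" unfolding e_def by (rule completion_nu.finite_measure_mono[OF F(2) E])
    then show "ennreal (h * ?\<mu> F) \<le> m_perimeter m \<nu> F"
      using half by (intro cheeger F) simp
  qed (use E e half h PE in \<open>auto simp: e_def\<close>)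
  show "m_calibrable m \<nu> (- E)"
    (* c is the perimeter h * e of both E and its complement, divided by the measure of the
       complement. *)
  proof (rule m_calibrableI[where c = "h * (e / (1 - e))"])
    have frac: "e / (1 - e) \<le> 1" using half by simp
    show "m_perimeter m \<nu> (- E) = ennreal (h * (e / (1 - e)) * ?\<mu> (- E))"
      using half by (simp add: m_perimeter_Compl[OF E] PE compl[OF E] e_def[symmetric])
    fix F assume F: "F \<in> sets (completion \<nu>)" "F \<subseteq> - E"
    have Fc: "- F \<in> sets (completion \<nu>)"
      by (rule Compl_sets_completion[OF F(1)])
    show "ennreal (h * (e / (1 - e)) * ?\<mu> F) \<le> m_perimeter m \<nu> F"
    proof (cases "?\<mu> F \<le> 1 / 2")
      case True
      have "h * (e / (1 - e)) * ?\<mu> F \<le> h * 1 * ?\<mu> F"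
        using h frac by (intro mult_left_mono mult_right_mono) auto
      then show ?thesis
        using cheeger[OF F(1) True] by (auto intro: order_trans[OF ennreal_leI])
    next
      case False
      have "e \<le> ?\<mu> (- F)"
        unfolding e_def using F(2) by (intro completion_nu.finite_measure_mono Fc) auto
      moreover have "?\<mu> F \<le> 1 - e"
        using completion_nu.finite_measure_mono[OF F(2) Ec] compl[OF E] by (simp add: e_def)
      then have "(e / (1 - e)) * ?\<mu> F \<le> (e / (1 - e)) * (1 - e)"
        using e half by (intro mult_left_mono) auto
      ultimately have "(e / (1 - e)) * ?\<mu> F \<le> ?\<mu> (- F)" using half by simp
      then have "h * (e / (1 - e)) * ?\<mu> F \<le> h * ?\<mu> (- F)"
        using h by (simp only: mult.assoc) (intro mult_left_mono, auto)
      moreover have "ennreal (h * ?\<mu> (- F)) \<le> m_perimeter m \<nu> (- F)"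
        using False compl[OF F(1)] by (intro cheeger Fc) simp
      ultimately show ?thesis
        unfolding m_perimeter_Compl[OF F(1)] by (auto intro: order_trans[OF ennreal_leI])
    qed
  qed (use Ec e half h compl[OF E] in \<open>auto simp: e_def[symmetric]\<close>)
qed

end

theorem corollary6p17:
  fixes m :: "'a::polish_space \<Rightarrow> 'a measure" and \<nu> :: "'a measure"
    and h :: real and u :: "'a \<Rightarrow> real"
  assumes "reversible_random_walk_space m \<nu>"
    and "m_connected m \<nu>"
    and "m_cheeger_constant m \<nu> = ennreal h" and "0 < h" and "m_eigenvalue m \<nu> h"
    and "m_eigenpair m \<nu> h u"
    and "0 < measure (completion \<nu>) (positivity_set u)"
  shows "m_eigenpair m \<nu> h
           (\<lambda>x. 1 / measure (completion \<nu>) (positivity_set u) * indicator (positivity_set u) x)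
       \<and> measure (completion \<nu>) (positivity_set u) \<le> 1/2
       \<and> m_cheeger_constant m \<nu> = m_ratio m \<nu> (positivity_set u)
       \<and> m_calibrable m \<nu> (positivity_set u)
       \<and> m_calibrable m \<nu> (- positivity_set u)"
proof -
  interpret reversible_random_walk_space m \<nu> by fact
  interpret completion_nu: prob_space "completion \<nu>"
    using prob_space.prob_space_completion[OF prob_space_nu] .
  let ?E = "positivity_set u" and ?\<mu> = "measure (completion \<nu>)"
  let ?I = "\<lambda>w z. \<integral>x. w x * z x \<partial>completion \<nu>"
  define e where "e = ?\<mu> ?E"
  have e: "0 < e" using assms(7) by (simp add: e_def)
  note h = \<open>0 < h\<close>
  obtain \<xi> where \<xi>: "\<And>x. \<xi> x \<in> multi_sign (u x)" and w: "(\<lambda>x. h * \<xi> x) \<in> subdifferential_TV m \<nu> u"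
    using assms(6) by (auto simp: m_eigenpair_iff_subdifferential)
  let ?w = "\<lambda>x. h * \<xi> x"
  have \<xi>_pos: "\<xi> x = 1" if "0 < u x" for x
    using \<xi>[of x] that by (simp add: multi_sign_def)
  have \<xi>_bound: "- 1 \<le> \<xi> x" "\<xi> x \<le> 1" for x
    using \<xi>[of x] by (auto simp: multi_sign_def split: if_splits)
  have wL: "?w \<in> L2 \<nu>" and u: "u \<in> L2 \<nu>"
    and sub: "\<And>z. z \<in> L2 \<nu> \<Longrightarrow> ennreal (?I ?w z) \<le> total_variation m \<nu> z"
    using w by (auto simp: subdifferential_TV_iff)
  have um [measurable]: "u \<in> borel_measurable (completion \<nu>)" using u by (simp add: L2_def)
  have E [measurable]: "?E \<in> sets (completion \<nu>)"
    by (rule positivity_set_measurable[OF um])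
  have TVE: "total_variation m \<nu> (indicator ?E) = ennreal (h * e)"
    unfolding e_def using \<xi>_pos h by (intro total_variation_positivity_set[OF w]) auto
  have PE: "m_perimeter m \<nu> ?E = ennreal (h * e)"
    using TVE total_variation_indicator[OF E] by simp
  have EL: "(indicator ?E :: 'a \<Rightarrow> real) \<in> L2 \<nu>" by (rule L2_indicator[OF E])
  let ?v = "\<lambda>x. 1 / e * indicator ?E x :: real"
  have vL: "?v \<in> L2 \<nu>" by (rule L2_scale[OF EL])

  have "m_eigenpair m \<nu> h ?v"
    unfolding m_eigenpair_iff_subdifferential
  proof (intro conjI exI[of _ \<xi>] allI vL)
    show "(\<integral>x. \<bar>?v x\<bar> \<partial>completion \<nu>) = 1"
      using e by (simp add: abs_mult) (simp add: e_def)
    (* The sign of ?v is {1} on E, where \<xi> = 1, and the whole interval [-1, 1] elsewhere. *)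
    show "\<xi> x \<in> multi_sign (?v x)" for x
      using e \<xi>_pos[of x] \<xi>_bound[of x] by (simp add: multi_sign_def indicator_def positivity_set_def)
    have "total_variation m \<nu> ?v = ennreal (1 / e) * ennreal (h * e)"
      unfolding TVE[symmetric] using e by (intro total_variation_scale) auto
    also have "\<dots> = ennreal h"
      using e h by (simp add: ennreal_mult'[symmetric])
    also have "h = ?I ?w ?v"
    proof -
      have "?I ?w ?v = (\<integral>x. h / e * indicator ?E x \<partial>completion \<nu>)"
        by (rule Bochner_Integration.integral_cong) (auto simp: indicator_def positivity_set_def \<xi>_pos)
      then show ?thesis using e by (simp add: e_def)
    qed
    finally show "?w \<in> subdifferential_TV m \<nu> ?v"
      using wL vL sub by (simp add: subdifferential_TV_iff)
  qed

  moreover have half: "e \<le> 1 / 2"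
  proof -
    have wi: "integrable (completion \<nu>) ?w"
      using integrable_mult_L2[OF wL L2_const[of 1]] by simp
    have Ei: "integrable (completion \<nu>) (indicator ?E :: 'a \<Rightarrow> real)"
      using integrable_mult_L2[OF EL L2_const[of 1]] by simp
    (* Constants have zero total variation, so the test function 1 bounds the integral of w;
       and \<xi> is at least 1 on E and at least -1 elsewhere. *)
    have "ennreal (\<integral>x. ?w x \<partial>completion \<nu>) \<le> 0"
      using sub[OF L2_const[of 1]] by (simp add: total_variation_eq)
    then have "(\<integral>x. ?w x \<partial>completion \<nu>) \<le> 0"
      by (simp add: ennreal_eq_0_iff)
    moreover have "(\<integral>x. h * (2 * indicator ?E x - 1) \<partial>completion \<nu>) \<le> (\<integral>x. ?w x \<partial>completion \<nu>)"
    proof (intro integral_mono wi)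
      show "h * (2 * indicator ?E x - 1) \<le> ?w x" for x
        using h \<xi>_pos[of x] \<xi>_bound[of x] by (intro mult_left_mono) (auto simp: indicator_def positivity_set_def)
    qed (intro Bochner_Integration.integrable_diff integrable_mult_right Ei
        completion_nu.integrable_const)
    moreover have "(\<integral>x. h * (2 * indicator ?E x - 1) \<partial>completion \<nu>) = h * (2 * e - 1)"
      using Ei completion_nu.prob_space by (simp add: e_def)
    ultimately have "h * (2 * e - 1) \<le> 0" by linarith
    then show ?thesis using h by (simp add: mult_le_0_iff)
  qed

  moreover have "m_cheeger_constant m \<nu> = m_ratio m \<nu> ?E"
    using m_ratio_eq[OF PE] e h assms(3) by (simp add: e_def)

  moreover have "m_calibrable m \<nu> ?E \<and> m_calibrable m \<nu> (- ?E)"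
    using assms(3) h E e half PE by (intro m_calibrable_Cheeger_set conjI) (simp_all add: e_def)

  ultimately show ?thesis by (simp add: e_def)
qed

end
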